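(* For all $n\ge1$ and $k\ge1$, $$\mathrm{per}\big(z;(a_0I_n+a_1P_n)\otimes J_k\big)=\sum_{s=0}^k\frac{(z)^{(s)}}{s!}\Big[s!\binom{k}{s}a_0^{k-s}a_1^{s}(s+z)^{(k-s)}\Big]^n,$$ as an identity of polynomials in the indeterminates $a_0,a_1,z$.
   Context: $I_n$ is the $n\times n$ identity matrix, $P_n$ is the $n\times n$ permutation matrix of the cyclic permutation $(1\,2\,\cdots\,n)$ (entries $(P_n)_{i,i+1}=1$, indices mod $n$; $P_1=I_1$), $J_k$ is the $k\times k$ all-ones matrix, and $\otimes$ is the Kronecker product (the matrix $(c_{i,j})\otimes J_k$ has blocks $c_{i,j}J_k$). For $k\ge1$, $(z)^{(k)}=\prod_{i=0}^{k-1}(z+i)$ and $(z)^{(0)}=1$. For an $N\times N$ matrix $B=(b_{i,j})$, the cyclic permanent is $\mathrm{per}(z;B)=\sum_{\sigma\in S_N}z^{c(\sigma)}\prod_{i=1}^N b_{i,\sigma(i)}$, where $c(\sigma)$ is the number of cycles of the permutation $\sigma$. *)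

theory Defs
  imports
    "HOL-Library.Poly_Mapping"
    "HOL-Combinatorics.Orbits"
    "Jordan_Normal_Form.Matrix"
begin

text \<open>
  The polynomial ring \<open>'c[a0, a1, z]\<close> is the monoid algebra over the exponent vectors
  \<open>indet \<Rightarrow>\<^sub>0 nat\<close>: elements of \<open>'c pol\<close> are finitely supported families of coefficients.
\<close>

datatype indet = A0 | A1 | Z

type_synonym 'c pol = "(indet \<Rightarrow>\<^sub>0 nat) \<Rightarrow>\<^sub>0 'c"

definition Var :: "indet \<Rightarrow> 'c::zero_neq_one pol" where
  "Var x = Poly_Mapping.single (Poly_Mapping.single x 1) 1"

definition Const :: "'c::zero \<Rightarrow> 'c pol" where
  "Const c = Poly_Mapping.single 0 c"

text \<open>
  Matrix indices start at 0. The remainder makes \<open>cyclic_perm_mat 1\<close> the identity matrix.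
\<close>

definition cyclic_perm_mat :: "nat \<Rightarrow> 'a::zero_neq_one mat" where
  "cyclic_perm_mat n = mat n n (\<lambda>(i, j). if j = (i + 1) mod n then 1 else 0)"

definition all_ones_mat :: "nat \<Rightarrow> 'a::one mat" where
  "all_ones_mat k = mat k k (\<lambda>_. 1)"

definition kronecker_product :: "'a::times mat \<Rightarrow> 'a mat \<Rightarrow> 'a mat" where
  "kronecker_product A B =
     mat (dim_row A * dim_row B) (dim_col A * dim_col B)
       (\<lambda>(i, j). A $$ (i div dim_row B, j div dim_col B) * B $$ (i mod dim_row B, j mod dim_col B))"

text \<open>
  The cycles of a permutation of \<open>S\<close>, fixed points included, are its orbits on \<open>S\<close>.
\<close>

definition num_cycles_on :: "'b set \<Rightarrow> ('b \<Rightarrow> 'b) \<Rightarrow> nat" where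
  "num_cycles_on S \<sigma> = card (orbit \<sigma> ` S)"

text \<open>Only meaningful for square matrices.\<close>

definition cyclic_permanent :: "'a::comm_semiring_1 \<Rightarrow> 'a mat \<Rightarrow> 'a" where
  "cyclic_permanent z B =
     (\<Sum>\<sigma> | \<sigma> permutes {0..<dim_row B}.
        z ^ num_cycles_on {0..<dim_row B} \<sigma> * (\<Prod>i = 0..<dim_row B. B $$ (i, \<sigma> i)))"

end

theory Submission
  imports Defs
begin

text \<open>
  Expanding the product of the entries, each index either stays in its block (weight \<open>a0\<close>) or
  moves to the next one (weight \<open>a1\<close>). Read the indices as arcs of a multigraph whose vertices
  are the blocks: staying indices are loops, moving ones are arcs of the directed \<open>n\<close>-cycle, and
  the permutations to be counted are the decompositions of the arc set into circuits. Each vertex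
  must have the same in- and out-degree, so every block has the same number \<open>s\<close> of moving
  indices, chosen in \<open>(k choose s) ^ n\<close> ways. Inserting the \<open>k - s\<close> loops of a block one at a time
  contributes \<open>(s + z) (s + 1 + z) \<dots> (k - 1 + z)\<close>. In the remaining cycle with \<open>s\<close> parallel
  arcs, bypassing a vertex matches its in-arcs with its out-arcs and contributes \<open>s!\<close>; after
  \<open>n - 1\<close> bypasses there are \<open>s\<close> loops at one vertex, which contribute \<open>z (z + 1) \<dots> (z + s - 1)\<close>.
\<close>

section \<open>Cycle counts when one point is added to a permutation\<close>

lemma num_cycles_on_insert_fixpoint:
  assumes q: "q permutes A" and x: "x \<notin> A" and fin: "finite A"
  shows "num_cycles_on (insert x A) q = Suc (num_cycles_on A q)"
proof -
  have qx: "q x = x" using q x by (simp add: permutes_not_in)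
  have sub: "orbit q a \<subseteq> A" if "a \<in> A" for a
    using permutes_orbit_subset[OF q that] .
  have "x \<in> orbit q x" using qx by (metis orbit.base)
  then have "orbit q x \<notin> orbit q ` A" using sub x by fastforce
  then show ?thesis using fin by (simp add: num_cycles_on_def)
qed

text \<open>The composition sends the predecessor of \<open>y\<close> to \<open>x\<close> and sends
  \<open>x\<close> to \<open>y\<close>. So \<open>x\<close> is spliced into the cycle through
  \<open>y\<close>, directly before \<open>y\<close>, and every other cycle stays as it is.\<close>

lemma orbit_transpose_comp:
  assumes q: "q permutes A" and x: "x \<notin> A" and y: "y \<in> A" and a: "a \<in> A" and fin: "finite A"
  shows "orbit (transpose x y \<circ> q) a = orbit q a \<union> (if y \<in> orbit q a then {x} else {})"
    (is "orbit ?s a = ?R")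
proof
  have qx: "q x = x" using q x by (simp add: permutes_not_in)
  have qA: "q b \<in> A" if "b \<in> A" for b using permutes_in_image[OF q] that by simp
  have sx: "?s x = y" using qx by simp
  have sb: "?s b = (if q b = y then x else q b)" if "b \<in> A" for b
    using qA[OF that] x by (auto simp: transpose_def)
  have sub: "orbit q a \<subseteq> A" using permutes_orbit_subset[OF q a] .
  show "orbit ?s a \<subseteq> ?R"
  proof
    fix c assume "c \<in> orbit ?s a"
    then show "c \<in> ?R"
    proof induction
      case base
      then show ?case using sb[OF a] orbit.base[of q a] by auto
    next
      case (step c)
      show ?case
      proof (cases "c = x")
        case True
        then have "y \<in> orbit q a" using step.IH sub x by (auto split: if_splits)
        then show ?thesis using True sx by simp
      next
        case False
        then have c: "c \<in> orbit q a" using step.IH by (auto split: if_splits)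
        then have "c \<in> A" using sub by auto
        with c show ?thesis using sb[of c] orbit.step[of c q a] by auto
      qed
    qed
  qed
  have sp: "?s permutes insert x A"
    by (intro permutes_compose permutes_subset[OF q] permutes_swap_id) (use y in auto)
  \<comment> \<open>\<open>orbit\<close> starts at the image of its base point; that it returns to
    \<open>a\<close> itself uses that \<open>?s\<close> permutes a finite set.\<close>
  have aa: "a \<in> orbit ?s a"
    by (rule permutation_self_in_orbit)
       (use sp fin in \<open>auto simp: permutation_permutes intro!: exI[of _ "insert x A"]\<close>)
  have stp: "q b \<in> orbit ?s a \<and> (q b = y \<longrightarrow> x \<in> orbit ?s a)"
    if "b \<in> orbit ?s a" "b \<in> A" for b
  proof (cases "q b = y")
    case True
    then have "x \<in> orbit ?s a" using orbit.step[OF that(1)] sb[OF that(2)] by simp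
    then show ?thesis using orbit.step[of x ?s a] sx True by simp
  next
    case False
    then show ?thesis using orbit.step[OF that(1)] sb[OF that(2)] by simp
  qed
  \<comment> \<open>The second conjunct is carried along because the new permutation enters
    \<open>y\<close> only through \<open>x\<close>.\<close>
  have ind: "c \<in> orbit ?s a \<and> (c = y \<longrightarrow> x \<in> orbit ?s a)" if "c \<in> orbit q a" for c
    using that
  proof induction
    case base
    then show ?case using stp[OF aa a] by blast
  next
    case (step c)
    then show ?case using stp[of c] sub by blast
  qed
  then show "?R \<subseteq> orbit ?s a" by auto
qed

text \<open>The point \<open>x\<close> lies in the same new cycle as \<open>y\<close>, so no cycle
  is created; old cycles remain distinct because deleting \<open>x\<close> recovers them.\<close>

lemma num_cycles_on_insert_transpose:
  assumes q: "q permutes A" and x: "x \<notin> A" and y: "y \<in> A" and fin: "finite A"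
  shows "num_cycles_on (insert x A) (transpose x y \<circ> q) = num_cycles_on A q"
proof -
  let ?s = "transpose x y \<circ> q"
  let ?g = "\<lambda>C. C \<union> (if y \<in> C then {x} else {})"
  have sub: "orbit q a \<subseteq> A" if "a \<in> A" for a using permutes_orbit_subset[OF q that] .
  have sp: "?s permutes insert x A"
    by (intro permutes_compose permutes_subset[OF q] permutes_swap_id) (use y in auto)
  have perm: "permutation ?s"
    using sp fin by (auto simp: permutation_permutes intro!: exI[of _ "insert x A"])
  have "y \<in> orbit ?s x"
    using orbit.base[of ?s x] q x by (simp add: permutes_not_in)
  then have "orbit ?s x = orbit ?s y"
    using perm by (metis cyclic_on_orbit' orbit_cyclic_eq3)
  then have "orbit ?s ` insert x A = orbit ?s ` A" using y by auto
  also have "\<dots> = ?g ` (orbit q ` A)"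
    using orbit_transpose_comp[OF q x y _ fin] by (auto simp: image_image)
  finally have *: "orbit ?s ` insert x A = ?g ` (orbit q ` A)" .
  have "inj_on ?g (orbit q ` A)"
  proof (rule inj_on_inverseI[where g = "\<lambda>C. C - {x}"])
    fix C assume "C \<in> orbit q ` A"
    then show "?g C - {x} = C" using sub x by (auto split: if_splits)
  qed
  then show ?thesis unfolding num_cycles_on_def * by (rule card_image)
qed

section \<open>Circuit sums: inserting, balancing and bypassing arcs\<close>

text \<open>
  The elements of \<open>A\<close> are arcs, and \<open>\<sigma> a\<close> is the arc that follows \<open>a\<close>; so \<open>\<sigma>\<close> decomposes
  the arc set into circuits.
\<close>

definition circuit_sum ::
  "'a::comm_semiring_1 \<Rightarrow> 'b set \<Rightarrow> ('b \<Rightarrow> 'v) \<Rightarrow> ('b \<Rightarrow> 'v) \<Rightarrow> 'a" where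
  "circuit_sum z A tail head =
     (\<Sum>\<sigma> | \<sigma> permutes A. if \<forall>a\<in>A. head a = tail (\<sigma> a) then z ^ num_cycles_on A \<sigma> else 0)"

lemma circuit_sum_cong:
  assumes "\<And>a. a \<in> A \<Longrightarrow> tail a = tail' a" and "\<And>a. a \<in> A \<Longrightarrow> head a = head' a"
  shows "circuit_sum z A tail head = circuit_sum z A tail' head'"
proof -
  have "head a = tail (\<sigma> a) \<longleftrightarrow> head' a = tail' (\<sigma> a)" if "\<sigma> permutes A" "a \<in> A" for \<sigma> a
    using assms that by (simp add: permutes_in_image)
  then show ?thesis
    unfolding circuit_sum_def by (intro sum.cong refl if_cong ball_cong) auto
qed

lemma circuit_sum_empty [simp]: "circuit_sum z {} tail head = 1"
  unfolding circuit_sum_def permutes_empty by (simp add: num_cycles_on_def)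

text \<open>
  Either \<open>x\<close> is a circuit by itself, or it is merged with its successor \<open>y\<close> into a single arc.
\<close>

lemma circuit_sum_insert:
  assumes fin: "finite A" and x: "x \<notin> A"
  shows "circuit_sum z (insert x A) tail head =
     (if head x = tail x then z * circuit_sum z A tail head else 0) +
     (\<Sum>y\<in>A. if tail y = head x then circuit_sum z A (tail(y := tail x)) head else 0)"
proof -
  define f where "f \<sigma> = (if \<forall>a\<in>insert x A. head a = tail (\<sigma> a)
    then z ^ num_cycles_on (insert x A) \<sigma> else 0)" for \<sigma>
  have fixed: "f q = (if head x = tail x then z *
      (if \<forall>a\<in>A. head a = tail (q a) then z ^ num_cycles_on A q else 0) else 0)"
    if q: "q permutes A" for q
    using num_cycles_on_insert_fixpoint[OF q x fin] q x by (auto simp: f_def permutes_not_in)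
  \<comment> \<open>The merged arc keeps the name \<open>y\<close> and the head of \<open>y\<close>,
    but takes over the tail of \<open>x\<close>. The condition at \<open>x\<close> itself becomes
    \<open>tail y = head x\<close>.\<close>
  have moved: "f (transpose x y \<circ> q) = (if tail y = head x then
      (if \<forall>a\<in>A. head a = (tail(y := tail x)) (q a) then z ^ num_cycles_on A q else 0) else 0)"
    if q: "q permutes A" and y: "y \<in> A" for q y
  proof -
    have "q x = x" using q x by (simp add: permutes_not_in)
    moreover have "tail (transpose x y (q a)) = (tail(y := tail x)) (q a)" if "a \<in> A" for a
    proof -
      have "q a \<noteq> x" using permutes_in_image[OF q, of a] that x by auto
      then show ?thesis by (auto simp: transpose_def)
    qed
    ultimately show ?thesis
      using num_cycles_on_insert_transpose[OF q x y fin] by (auto simp: f_def simp del: fun_upd_apply)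
  qed
  have "circuit_sum z (insert x A) tail head = sum f {\<sigma>. \<sigma> permutes insert x A}"
    by (simp add: circuit_sum_def f_def)
  \<comment> \<open>The index \<open>b\<close> is the successor of \<open>x\<close>; for
    \<open>b = x\<close> the transposition is the identity and \<open>x\<close> is a fixed
    point.\<close>
  also have "\<dots> = (\<Sum>b\<in>insert x A. \<Sum>q | q permutes A. f (transpose x b \<circ> q))"
    by (rule sum_over_permutations_insert[OF fin x])
  also have "\<dots> = (\<Sum>q | q permutes A. f q) + (\<Sum>y\<in>A. \<Sum>q | q permutes A. f (transpose x y \<circ> q))"
    using fin x by simp
  also have "(\<Sum>q | q permutes A. f q) =
      (if head x = tail x then z * circuit_sum z A tail head else 0)"
    using fixed by (simp add: circuit_sum_def sum_distrib_left)
  also have "(\<Sum>y\<in>A. \<Sum>q | q permutes A. f (transpose x y \<circ> q)) =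
      (\<Sum>y\<in>A. if tail y = head x then circuit_sum z A (tail(y := tail x)) head else 0)"
    using moved by (intro sum.cong) (simp_all add: circuit_sum_def del: fun_upd_apply)
  finally show ?thesis .
qed

text \<open>A loop is a circuit by itself, which gives \<open>z\<close>, or is followed by one of
  the arcs leaving its vertex. In the latter case merging changes no tail, so all choices give the
  same sum.\<close>

lemma circuit_sum_insert_loop:
  assumes "finite A" and "x \<notin> A" and "head x = tail x"
  shows "circuit_sum z (insert x A) tail head =
     (z + of_nat (card {y \<in> A. tail y = tail x})) * circuit_sum z A tail head"
proof -
  have *: "tail(y := tail x) = tail" if "tail y = tail x" for y
    using that by auto
  have "(\<Sum>y\<in>A. if tail y = tail x then circuit_sum z A (tail(y := tail x)) head else 0)
     = (\<Sum>y\<in>A. if tail y = tail x then circuit_sum z A tail head else 0)"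
    using * by (intro sum.cong) auto
  also have "\<dots> = of_nat (card {y \<in> A. tail y = tail x}) * circuit_sum z A tail head"
    using assms(1) by (simp flip: sum.inter_filter)
  finally show ?thesis
    using assms by (simp add: circuit_sum_insert distrib_right)
qed

text \<open>An admissible \<open>\<sigma>\<close> would map the arcs entering \<open>v\<close>
  bijectively onto those leaving \<open>v\<close>.\<close>

lemma circuit_sum_eq_0:
  assumes "finite A" and "card {a \<in> A. tail a = v} \<noteq> card {a \<in> A. head a = v}"
  shows "circuit_sum z A tail head = 0"
proof -
  have "\<not> (\<forall>a\<in>A. head a = tail (\<sigma> a))" if \<sigma>: "\<sigma> permutes A" for \<sigma>
  proof
    assume h: "\<forall>a\<in>A. head a = tail (\<sigma> a)"
    have "{a \<in> A. head a = v} = {a \<in> A. tail (\<sigma> a) = v}"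
      using h by (intro Collect_cong conj_cong refl) simp
    then have "\<sigma> ` {a \<in> A. head a = v} = \<sigma> ` {a \<in> A. tail (\<sigma> a) = v}" by (rule arg_cong)
    also have "\<dots> = {b \<in> \<sigma> ` A. tail b = v}" by blast
    also have "\<dots> = {b \<in> A. tail b = v}" by (simp only: permutes_image[OF \<sigma>])
    finally have "card {b \<in> A. tail b = v} = card {a \<in> A. head a = v}"
      using card_image[OF permutes_inj_on[OF \<sigma>], of "{a \<in> A. head a = v}"] by simp
    with assms(2) show False by contradiction
  qed
  then show ?thesis unfolding circuit_sum_def by (intro sum.neutral ballI if_not_P) blast
qed

text \<open>Every arc into \<open>v\<close> comes from \<open>u\<close>, so merging it with any arc
  out of \<open>v\<close> yields an arc out of \<open>u\<close>. All \<open>fact m\<close> ways to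
  match in-arcs with out-arcs thus lead to the same arc set; the induction matches one in-arc
  \<open>x\<close> at a time.\<close>

lemma circuit_sum_bypass:
  assumes "finite A" and "u \<noteq> v"
    and "\<And>a. a \<in> A \<Longrightarrow> head a = v \<Longrightarrow> tail a = u"
    and "card {a \<in> A. head a = v} = m" and "card {a \<in> A. tail a = v} = m"
  shows "circuit_sum z A tail head = fact m *
    circuit_sum z {a \<in> A. head a \<noteq> v} (\<lambda>a. if tail a = v then u else tail a) head"
  using assms
proof (induction m arbitrary: A tail)
  case 0
  then have "{a \<in> A. head a = v} = {}" "{a \<in> A. tail a = v} = {}" by auto
  then have "{a \<in> A. head a \<noteq> v} = A" and "\<And>a. a \<in> A \<Longrightarrow> tail a \<noteq> v" by auto
  then show ?case by (auto intro: circuit_sum_cong)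
next
  case (Suc m)
  from Suc.prems(4) have "{a \<in> A. head a = v} \<noteq> {}" by force
  then obtain x where x: "x \<in> A" "head x = v" by auto
  define B where "B = A - {x}"
  have B: "A = insert x B" "x \<notin> B" "finite B" using x Suc.prems(1) by (auto simp: B_def)
  have tx: "tail x = u" using Suc.prems(3) x by auto
  let ?C = "circuit_sum z {a \<in> A. head a \<noteq> v} (\<lambda>a. if tail a = v then u else tail a) head"
  have each: "circuit_sum z B (tail(y := tail x)) head = fact m * ?C" if y: "y \<in> B" "tail y = v" for y
  proof -
    have "circuit_sum z B (tail(y := tail x)) head = fact m * circuit_sum z {a \<in> B. head a \<noteq> v}
      (\<lambda>a. if (tail(y := tail x)) a = v then u else (tail(y := tail x)) a) head"
    proof (rule Suc.IH[OF B(3) Suc.prems(2)])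
      show "(tail(y := tail x)) a = u" if "a \<in> B" "head a = v" for a
        using Suc.prems(3)[of a] that tx B(1) by auto
      have "{a \<in> B. head a = v} = {a \<in> A. head a = v} - {x}" by (auto simp: B_def)
      then show "card {a \<in> B. head a = v} = m" using Suc.prems(4) x by simp
      have "{a \<in> B. (tail(y := tail x)) a = v} = {a \<in> A. tail a = v} - {y}"
        using tx Suc.prems(2) y by (auto simp: B_def)
      moreover have "y \<in> A" using y B by simp
      ultimately show "card {a \<in> B. (tail(y := tail x)) a = v} = m"
        using Suc.prems(5) y by simp
    qed
    also have "{a \<in> B. head a \<noteq> v} = {a \<in> A. head a \<noteq> v}" using x by (auto simp: B_def)
    also have "(\<lambda>a. if (tail(y := tail x)) a = v then u else (tail(y := tail x)) a) =
      (\<lambda>a. if tail a = v then u else tail a)" using y tx Suc.prems(2) by auto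
    finally show ?thesis .
  qed
  \<comment> \<open>Since \<open>x\<close> leaves \<open>u\<close> and not \<open>v\<close>, its
    removal keeps all \<open>Suc m\<close> candidates for its successor, and \<open>x\<close> cannot
    close up on itself.\<close>
  have "{a \<in> B. tail a = v} = {a \<in> A. tail a = v}" using tx Suc.prems(2) by (auto simp: B_def)
  then have card: "card {a \<in> B. tail a = v} = Suc m" using Suc.prems(5) by simp
  have "circuit_sum z A tail head =
      (\<Sum>y\<in>B. if tail y = v then circuit_sum z B (tail(y := tail x)) head else 0)"
    unfolding B(1) using circuit_sum_insert[OF B(3) B(2), of z tail head] x tx Suc.prems(2) by simp
  also have "\<dots> = (\<Sum>y\<in>B. if tail y = v then fact m * ?C else 0)"
    using each by (intro sum.cong) auto
  also have "\<dots> = of_nat (card {a \<in> B. tail a = v}) * (fact m * ?C)"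
    using B(3) by (simp flip: sum.inter_filter)
  also have "\<dots> = fact (Suc m) * ?C" by (simp add: card algebra_simps)
  finally show ?case .
qed

text \<open>When \<open>c\<close> loops of \<open>L\<close> are already present at \<open>v\<close>,
  \<open>s + c\<close> arcs leave \<open>v\<close>, so the next loop contributes the factor
  \<open>z + s + c\<close>. Loops at different vertices do not interact.\<close>

lemma circuit_sum_add_loops:
  assumes "finite L" and "finite A" and "A \<inter> L = {}"
    and "\<And>x. x \<in> L \<Longrightarrow> head x = tail x \<and> tail x \<in> V" and "finite V"
    and "\<And>v. v \<in> V \<Longrightarrow> card {a \<in> A. tail a = v} = s"
  shows "circuit_sum z (A \<union> L) tail head =
    circuit_sum z A tail head * (\<Prod>v\<in>V. pochhammer (of_nat s + z) (card {x \<in> L. tail x = v}))"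
  using assms
proof (induction L rule: finite_induct)
  case empty
  then show ?case by simp
next
  case (insert x L)
  let ?c = "\<lambda>L v. card {a \<in> L. tail a = v}"
  have tV: "tail x \<in> V" using insert.prems by auto
  have "?c (A \<union> L) (tail x) = s + ?c L (tail x)"
  proof -
    have "{a \<in> A \<union> L. tail a = tail x} = {a \<in> A. tail a = tail x} \<union> {a \<in> L. tail a = tail x}" by auto
    moreover have "card \<dots> = ?c A (tail x) + ?c L (tail x)"
      using insert.prems insert.hyps by (intro card_Un_disjoint) auto
    ultimately show ?thesis using insert.prems(5)[OF tV] by simp
  qed
  then have "circuit_sum z (A \<union> insert x L) tail head =
      (z + of_nat (s + ?c L (tail x))) * circuit_sum z (A \<union> L) tail head"
    using circuit_sum_insert_loop[of "A \<union> L" x head tail z] insert by auto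
  also have "circuit_sum z (A \<union> L) tail head =
      circuit_sum z A tail head * (\<Prod>v\<in>V. pochhammer (of_nat s + z) (?c L v))"
    using insert by auto
  also have "(\<Prod>v\<in>V. pochhammer (of_nat s + z) (?c L v)) =
     pochhammer (of_nat s + z) (?c L (tail x)) * (\<Prod>v\<in>V - {tail x}. pochhammer (of_nat s + z) (?c L v))"
    by (rule prod.remove[OF insert.prems(4) tV])
  also have "(\<Prod>v\<in>V - {tail x}. pochhammer (of_nat s + z) (?c L v)) =
      (\<Prod>v\<in>V - {tail x}. pochhammer (of_nat s + z) (?c (insert x L) v))"
    by (intro prod.cong refl arg_cong2[where f = pochhammer] arg_cong[where f = card]) auto
  finally have 1: "circuit_sum z (A \<union> insert x L) tail head =
     circuit_sum z A tail head * (pochhammer (of_nat s + z) (Suc (?c L (tail x))) *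
       (\<Prod>v\<in>V - {tail x}. pochhammer (of_nat s + z) (?c (insert x L) v)))"
    by (simp add: pochhammer_Suc algebra_simps)
  have "{a \<in> insert x L. tail a = tail x} = insert x {a \<in> L. tail a = tail x}" by auto
  then have "?c (insert x L) (tail x) = Suc (?c L (tail x))"
    using insert.hyps by simp
  then show ?case unfolding 1 using tV insert.prems(4)
    by (subst prod.remove[OF insert.prems(4) tV]) simp
qed

section \<open>Evaluation on loops at one vertex and on the directed cycle\<close>

text \<open>With a single vertex every permutation is admissible, so this is the classical
  generating function of permutations by number of cycles.\<close>

lemma circuit_sum_loops:
  assumes "finite A" and "\<And>a. a \<in> A \<Longrightarrow> head a = tail a \<and> tail a = v"
  shows "circuit_sum z A tail head = pochhammer z (card A)"
proof -
  have "{x \<in> A. tail x = v} = A" using assms by auto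
  then show ?thesis
    using circuit_sum_add_loops[of A "{}" head tail "{v}" 0 z] assms by simp
qed

lemma circuit_sum_cycle:
  assumes fin: "finite A" and n: "n \<ge> 1"
    and lt: "\<And>a. a \<in> A \<Longrightarrow> tail a < n"
    and card: "\<And>v. v < n \<Longrightarrow> card {a \<in> A. tail a = v} = s"
  shows "circuit_sum z A tail (\<lambda>a. Suc (tail a) mod n) = fact s ^ (n - 1) * pochhammer z s"
proof -
  let ?h = "\<lambda>a. Suc (tail a) mod n"
  let ?t = "\<lambda>j a. if tail a = j then 0 else tail a"
  \<comment> \<open>State after bypassing the vertices 1 to \<open>j\<close>: the arcs that left
    \<open>j\<close> now leave 0, and the arcs from earlier vertices have been absorbed.\<close>
  have "circuit_sum z A tail ?h = fact s ^ j * circuit_sum z {a \<in> A. j \<le> tail a} (?t j) ?h"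
    if "j \<le> n - 1" for j
    using that
  proof (induction j)
    case 0
    then show ?case by (auto intro!: circuit_sum_cong)
  next
    case (Suc j)
    let ?A = "{a \<in> A. j \<le> tail a}"
    have j: "Suc j < n" using Suc.prems n by simp
    \<comment> \<open>As \<open>Suc j < n\<close>, an arc that wraps around to 0 does not
      interfere.\<close>
    have hd: "?h a = Suc j \<longleftrightarrow> tail a = j" if "a \<in> A" for a
      using lt[OF that] j by (cases "Suc (tail a) = n") auto
    have e1: "{a \<in> ?A. ?h a = Suc j} = {a \<in> A. tail a = j}" using hd by auto
    have e2: "{a \<in> ?A. ?t j a = Suc j} = {a \<in> A. tail a = Suc j}" by auto
    have e3: "{a \<in> ?A. ?h a \<noteq> Suc j} = {a \<in> A. Suc j \<le> tail a}" using hd by auto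
    have "circuit_sum z ?A (?t j) ?h = fact s * circuit_sum z {a \<in> ?A. ?h a \<noteq> Suc j}
        (\<lambda>a. if ?t j a = Suc j then 0 else ?t j a) ?h"
    proof (rule circuit_sum_bypass)
      show "finite ?A" using fin by simp
      show "?t j a = 0" if "a \<in> ?A" "?h a = Suc j" for a using that hd by auto
      show "card {a \<in> ?A. ?h a = Suc j} = s" unfolding e1 using card j by simp
      show "card {a \<in> ?A. ?t j a = Suc j} = s" unfolding e2 using card j by simp
    qed simp
    also have "\<dots> = fact s * circuit_sum z {a \<in> A. Suc j \<le> tail a} (?t (Suc j)) ?h"
      unfolding e3 by (intro arg_cong2[where f = "(*)"] refl circuit_sum_cong) auto
    finally show ?case using Suc by (simp add: ac_simps)
  qed
  from this[of "n - 1"]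
  have "circuit_sum z A tail ?h =
      fact s ^ (n - 1) * circuit_sum z {a \<in> A. n - 1 \<le> tail a} (?t (n - 1)) ?h" by simp
  also have "{a \<in> A. n - 1 \<le> tail a} = {a \<in> A. tail a = n - 1}" using lt by fastforce
  \<comment> \<open>The remaining arcs start at 0 and end at \<open>n mod n = 0\<close>, so they are
    \<open>s\<close> loops.\<close>
  also have "circuit_sum z {a \<in> A. tail a = n - 1} (?t (n - 1)) ?h = pochhammer z s"
    using circuit_sum_loops[of "{a \<in> A. tail a = n - 1}" ?h "?t (n - 1)" 0 z] fin n card[of "n - 1"]
    by simp
  finally show ?thesis .
qed

section \<open>Counting index sets by their blocks\<close>

text \<open>A subset of \<open>S\<close> amounts to an independent choice of its part in each fiber
  of \<open>f\<close>.\<close>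

lemma card_subsets_prescribed_fibers:
  assumes "finite S" and "finite V" and "f ` S \<subseteq> V"
  shows "card {T. T \<subseteq> S \<and> (\<forall>v\<in>V. card {x \<in> T. f x = v} = m v)} =
    (\<Prod>v\<in>V. card {x \<in> S. f x = v} choose m v)"
proof -
  let ?P = "\<lambda>v. {B. B \<subseteq> {x \<in> S. f x = v} \<and> card B = m v}"
  have "bij_betw (\<lambda>T. \<lambda>v\<in>V. {x \<in> T. f x = v})
      {T. T \<subseteq> S \<and> (\<forall>v\<in>V. card {x \<in> T. f x = v} = m v)} (PiE V ?P)"
  proof (rule bij_betw_byWitness[where f' = "\<lambda>F. \<Union>v\<in>V. F v"])
    show "\<forall>T\<in>{T. T \<subseteq> S \<and> (\<forall>v\<in>V. card {x \<in> T. f x = v} = m v)}.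
        (\<Union>v\<in>V. (\<lambda>v\<in>V. {x \<in> T. f x = v}) v) = T"
      using assms(3) by auto
    \<comment> \<open>Parts over different \<open>v\<close> lie in disjoint fibers, so cutting their
      union at \<open>v\<close> recovers \<open>F v\<close>.\<close>
    have fib: "{x \<in> \<Union> (F ` V). f x = v} = F v" if "F \<in> PiE V ?P" "v \<in> V" for F v
      using that by (fastforce simp: PiE_iff)
    show "\<forall>F\<in>PiE V ?P. (\<lambda>v\<in>V. {x \<in> \<Union> (F ` V). f x = v}) = F"
    proof
      fix F assume F: "F \<in> PiE V ?P"
      show "(\<lambda>v\<in>V. {x \<in> \<Union> (F ` V). f x = v}) = F"
      proof (rule extensionalityI[where A = V])
        show "F \<in> extensional V" using F by (simp add: PiE_iff)
      qed (use fib[OF F] in simp_all)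
    qed
    show "(\<lambda>T. \<lambda>v\<in>V. {x \<in> T. f x = v}) ` {T. T \<subseteq> S \<and> (\<forall>v\<in>V. card {x \<in> T. f x = v} = m v)}
      \<subseteq> PiE V ?P"
      by auto
    show "(\<lambda>F. \<Union> (F ` V)) ` PiE V ?P
      \<subseteq> {T. T \<subseteq> S \<and> (\<forall>v\<in>V. card {x \<in> T. f x = v} = m v)}"
    proof (intro image_subsetI CollectI conjI ballI)
      fix F assume F: "F \<in> PiE V ?P"
      show "\<Union> (F ` V) \<subseteq> S" using F by (fastforce simp: PiE_iff)
      show "card {x \<in> \<Union> (F ` V). f x = v} = m v" if "v \<in> V" for v
        unfolding fib[OF F that] using F that by (auto simp: PiE_iff)
    qed
  qed
  then have "card {T. T \<subseteq> S \<and> (\<forall>v\<in>V. card {x \<in> T. f x = v} = m v)} = card (PiE V ?P)"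
    by (rule bij_betw_same_card)
  also have "\<dots> = (\<Prod>v\<in>V. card {x \<in> S. f x = v} choose m v)"
    using assms by (simp add: card_PiE n_subsets)
  finally show ?thesis .
qed

lemma prod_if_zero:
  fixes c :: "'a::comm_semiring_1"
  assumes "finite T"
  shows "(\<Prod>i\<in>T. if P i then c else 0) = (if \<forall>i\<in>T. P i then c ^ card T else 0)"
  using assms by (induction T rule: finite_induct) auto

lemma card_div_fiber:
  fixes k :: nat
  assumes "k \<ge> 1" and "v < n"
  shows "card {x \<in> {0..<n * k}. x div k = v} = k"
proof -
  have "{x \<in> {0..<n * k}. x div k = v} = {v * k..<Suc v * k}"
  proof (intro equalityI subsetI)
    fix x assume x: "x \<in> {v * k..<Suc v * k}"
    have "Suc v * k \<le> n * k" using assms by (intro mult_le_mono1) simp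
    moreover have "x div k = v"
      using x by (intro div_nat_eqI) (auto simp: algebra_simps)
    ultimately show "x \<in> {x \<in> {0..<n * k}. x div k = v}" using x by auto
  next
    fix x assume x: "x \<in> {x \<in> {0..<n * k}. x div k = v}"
    have "x = v * k + x mod k" using x div_mult_mod_eq[of x k] by simp
    moreover have "x mod k < k" using assms(1) by simp
    ultimately show "x \<in> {v * k..<Suc v * k}" by (simp only: atLeastLessThan_iff mult_Suc) linarith
  qed
  then show ?thesis by simp
qed

section \<open>Expansion of the cyclic permanent and summation over index sets\<close>

text \<open>\<open>T\<close> is the set of moving indices, those at which the \<open>b\<close> term
  is taken when the product of the entries is multiplied out. Exchanging the sums leaves one circuit
  sum for each \<open>T\<close>.\<close>

lemma cyclic_permanent_two_blocks:
  fixes a b z :: "'a::comm_semiring_1"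
  assumes n: "n \<ge> 1" and k: "k \<ge> 1"
  shows "cyclic_permanent z (kronecker_product (a \<cdot>\<^sub>m 1\<^sub>m n + b \<cdot>\<^sub>m cyclic_perm_mat n) (all_ones_mat k)) =
    (\<Sum>T\<in>Pow {0..<n * k}. b ^ card T * a ^ card ({0..<n * k} - T) *
      circuit_sum z {0..<n * k} (\<lambda>x. x div k) (\<lambda>x. if x \<in> T then Suc (x div k) mod n else x div k))"
    (is "cyclic_permanent z ?B = _")
proof -
  let ?S = "{0..<n * k}"
  let ?h = "\<lambda>T x. if x \<in> T then Suc (x div k) mod n else x div k"
  have dim: "dim_row ?B = n * k"
    by (simp add: kronecker_product_def cyclic_perm_mat_def all_ones_mat_def)
  \<comment> \<open>The two cases are added rather than merged into one conditional: for
    \<open>n = 1\<close> both hold and the entry is \<open>a + b\<close>.\<close>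
  have entry: "?B $$ (i, j) = (if Suc (i div k) mod n = j div k then b else 0) +
      (if i div k = j div k then a else 0)" if "i \<in> ?S" "j \<in> ?S" for i j
  proof -
    have "i div k < n" "j div k < n" "i mod k < k" "j mod k < k"
      using that k by (auto simp: less_mult_imp_div_less)
    then show ?thesis using that
      by (auto simp: kronecker_product_def cyclic_perm_mat_def all_ones_mat_def add.commute)
  qed
  have prod: "(\<Prod>i\<in>?S. ?B $$ (i, \<sigma> i)) = (\<Sum>T\<in>Pow ?S.
      if \<forall>i\<in>?S. ?h T i = \<sigma> i div k then b ^ card T * a ^ card (?S - T) else 0)"
    if \<sigma>: "\<sigma> permutes ?S" for \<sigma>
  proof -
    have "(\<Prod>i\<in>?S. ?B $$ (i, \<sigma> i)) =
        (\<Prod>i\<in>?S. (if Suc (i div k) mod n = \<sigma> i div k then b else 0) +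
          (if i div k = \<sigma> i div k then a else 0))"
      by (intro prod.cong refl entry) (use permutes_in_image[OF \<sigma>] in auto)
    also have "\<dots> = (\<Sum>T\<in>Pow ?S. (\<Prod>i\<in>T. if Suc (i div k) mod n = \<sigma> i div k then b else 0) *
          (\<Prod>i\<in>?S - T. if i div k = \<sigma> i div k then a else 0))"
      by (rule prod_add) simp
    also have "\<dots> = (\<Sum>T\<in>Pow ?S.
        if \<forall>i\<in>?S. ?h T i = \<sigma> i div k then b ^ card T * a ^ card (?S - T) else 0)"
    proof (intro sum.cong refl)
      fix T assume T: "T \<in> Pow ?S"
      then have fT: "finite T" by (auto intro: finite_subset)
      have "(\<forall>i\<in>?S. ?h T i = \<sigma> i div k) \<longleftrightarrow>
          (\<forall>i\<in>T. Suc (i div k) mod n = \<sigma> i div k) \<and> (\<forall>i\<in>?S - T. i div k = \<sigma> i div k)"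
        using T by auto
      then show "(\<Prod>i\<in>T. if Suc (i div k) mod n = \<sigma> i div k then b else 0) *
          (\<Prod>i\<in>?S - T. if i div k = \<sigma> i div k then a else 0) =
        (if \<forall>i\<in>?S. ?h T i = \<sigma> i div k then b ^ card T * a ^ card (?S - T) else 0)"
        using fT by (simp only: prod_if_zero finite_Diff finite_atLeastLessThan) simp
    qed
    finally show ?thesis .
  qed
  have if_swap: "x * (if P then y else 0) = y * (if P then x else 0)" for x y :: 'a and P
    by (simp add: mult.commute)
  have "cyclic_permanent z ?B = (\<Sum>\<sigma> | \<sigma> permutes ?S. \<Sum>T\<in>Pow ?S. z ^ num_cycles_on ?S \<sigma> *
      (if \<forall>i\<in>?S. ?h T i = \<sigma> i div k then b ^ card T * a ^ card (?S - T) else 0))"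
    unfolding cyclic_permanent_def dim by (intro sum.cong refl) (simp only: prod mem_Collect_eq sum_distrib_left)
  also have "\<dots> = (\<Sum>T\<in>Pow ?S. \<Sum>\<sigma> | \<sigma> permutes ?S. z ^ num_cycles_on ?S \<sigma> *
      (if \<forall>i\<in>?S. ?h T i = \<sigma> i div k then b ^ card T * a ^ card (?S - T) else 0))"
    by (rule sum.swap)
  also have "\<dots> = (\<Sum>T\<in>Pow ?S. b ^ card T * a ^ card (?S - T) *
      circuit_sum z ?S (\<lambda>x. x div k) (?h T))"
    unfolding circuit_sum_def sum_distrib_left
    by (intro sum.cong refl if_swap)
  finally show ?thesis .
qed

text \<open>The arcs in \<open>T\<close> form the cycle with \<open>s\<close> parallel arcs per
  step; the \<open>k - s\<close> loops at each vertex are added afterwards.\<close>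

lemma circuit_sum_cycle_with_loops:
  assumes fin: "finite S" and T: "T \<subseteq> S" and n: "n \<ge> 1" and lt: "\<And>x. x \<in> S \<Longrightarrow> tail x < n"
    and cS: "\<And>v. v < n \<Longrightarrow> card {x \<in> S. tail x = v} = k"
    and cT: "\<And>v. v < n \<Longrightarrow> card {x \<in> T. tail x = v} = s"
  shows "circuit_sum z S tail (\<lambda>x. if x \<in> T then Suc (tail x) mod n else tail x) =
    fact s ^ (n - 1) * pochhammer z s * pochhammer (of_nat s + z) (k - s) ^ n"
proof -
  let ?h = "\<lambda>x. if x \<in> T then Suc (tail x) mod n else tail x"
  have fT: "finite T" using T fin by (rule finite_subset)
  have cL: "card {x \<in> S - T. tail x = v} = k - s" if "v < n" for v
  proof -
    have "{x \<in> S - T. tail x = v} = {x \<in> S. tail x = v} - {x \<in> T. tail x = v}" by auto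
    moreover have "{x \<in> T. tail x = v} \<subseteq> {x \<in> S. tail x = v}" using T by auto
    ultimately show ?thesis using fT cS[OF that] cT[OF that] by (simp add: card_Diff_subset)
  qed
  have "circuit_sum z (T \<union> (S - T)) tail ?h = circuit_sum z T tail ?h *
      (\<Prod>v\<in>{..<n}. pochhammer (of_nat s + z) (card {x \<in> S - T. tail x = v}))"
    by (rule circuit_sum_add_loops) (use fin fT lt cT in auto)
  also have "T \<union> (S - T) = S" using T by auto
  also have "(\<Prod>v\<in>{..<n}. pochhammer (of_nat s + z) (card {x \<in> S - T. tail x = v})) =
      pochhammer (of_nat s + z) (k - s) ^ n"
    using cL by simp
  also have "circuit_sum z T tail ?h = circuit_sum z T tail (\<lambda>x. Suc (tail x) mod n)"
    by (rule circuit_sum_cong) auto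
  also have "\<dots> = fact s ^ (n - 1) * pochhammer z s"
    using fT n T lt cT by (intro circuit_sum_cycle) auto
  finally show ?thesis .
qed

text \<open>In the degree balance at \<open>Suc v\<close> the loops count on both sides and cancel.
  What remains equates the moving arcs out of \<open>Suc v\<close> with those out of
  \<open>v\<close>, and induction leads back to vertex 0.\<close>

lemma circuit_sum_cycle_with_loops_eq_0:
  assumes fin: "finite S" and T: "T \<subseteq> S" and lt: "\<And>x. x \<in> S \<Longrightarrow> tail x < n"
    and nz: "circuit_sum z S tail (\<lambda>x. if x \<in> T then Suc (tail x) mod n else tail x) \<noteq> 0"
    and v: "v < n"
  shows "card {x \<in> T. tail x = v} = card {x \<in> T. tail x = 0}"
  using v
proof (induction v)
  case (Suc v)
  let ?h = "\<lambda>x. if x \<in> T then Suc (tail x) mod n else tail x"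
  let ?L = "{x \<in> S - T. tail x = Suc v}"
  have fT: "finite T" using T fin by (rule finite_subset)
  have iff: "Suc (tail x) mod n = Suc v \<longleftrightarrow> tail x = v" if "x \<in> T" for x
    using lt[of x] that T Suc.prems by (cases "Suc (tail x) = n") auto
  have "card {x \<in> T. tail x = Suc v} + card ?L = card {x \<in> S. tail x = Suc v}"
    using fT fin T by (subst card_Un_disjoint[symmetric]) (auto intro!: arg_cong[where f = card])
  also have "\<dots> = card {x \<in> S. ?h x = Suc v}"
    using circuit_sum_eq_0[OF fin, of tail "Suc v" ?h z] nz by blast
  also have "{x \<in> S. ?h x = Suc v} = {x \<in> T. tail x = v} \<union> ?L"
    using T iff by auto
  also have "card \<dots> = card {x \<in> T. tail x = v} + card ?L"
    using fT fin by (intro card_Un_disjoint) auto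
  finally show ?case using Suc by simp
qed simp

text \<open>The exponent \<open>n - 1\<close> of \<open>fact s\<close> absorbs the division by
  \<open>s!\<close>, so the formula makes sense in a semiring.\<close>

lemma cyclic_permanent_two_blocks_closed:
  fixes a b z :: "'a::{comm_semiring_1, semiring_char_0}"
  assumes n: "n \<ge> 1" and k: "k \<ge> 1"
  shows "cyclic_permanent z (kronecker_product (a \<cdot>\<^sub>m 1\<^sub>m n + b \<cdot>\<^sub>m cyclic_perm_mat n) (all_ones_mat k)) =
    (\<Sum>s = 0..k. fact s ^ (n - 1) * pochhammer z s *
      (of_nat (k choose s) * a ^ (k - s) * b ^ s * pochhammer (of_nat s + z) (k - s)) ^ n)"
proof -
  let ?S = "{0..<n * k}"
  let ?h = "\<lambda>T x. if x \<in> T then Suc (x div k) mod n else x div k"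
  let ?Q = "\<lambda>s. {T. T \<subseteq> ?S \<and> (\<forall>v\<in>{..<n}. card {x \<in> T. x div k = v} = s)}"
  define f where "f T = b ^ card T * a ^ card (?S - T) * circuit_sum z ?S (\<lambda>x. x div k) (?h T)" for T
  have lt: "x div k < n" if "x \<in> ?S" for x using that by (simp add: less_mult_imp_div_less)
  have card_le: "card {x \<in> T. x div k = v} \<le> k" if "T \<subseteq> ?S" "v < n" for T v
  proof -
    have "card {x \<in> T. x div k = v} \<le> card {x \<in> ?S. x div k = v}"
      using that(1) by (intro card_mono) auto
    then show ?thesis unfolding card_div_fiber[OF k that(2)] .
  qed
  have f_eq: "f T = a ^ (n * (k - s)) * b ^ (n * s) *
      (fact s ^ (n - 1) * pochhammer z s * pochhammer (of_nat s + z) (k - s) ^ n)"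
    if "T \<in> ?Q s" for T s
  proof -
    have T: "T \<subseteq> ?S" "\<And>v. v < n \<Longrightarrow> card {x \<in> T. x div k = v} = s" using that by auto
    have fT: "finite T" using T(1) by (rule finite_subset) simp
    have "card T = (\<Sum>v\<in>{..<n}. \<Sum>x\<in>{x \<in> T. x div k = v}. 1)"
      by (subst sum.group) (use fT T(1) lt in auto)
    also have "\<dots> = n * s" using T(2) by simp
    finally have cT: "card T = n * s" .
    have "card (?S - T) = n * (k - s)"
      using T(1) fT by (simp add: card_Diff_subset cT diff_mult_distrib2)
    then show ?thesis unfolding f_def
      using circuit_sum_cycle_with_loops[OF finite_atLeastLessThan T(1) n lt card_div_fiber[OF k] T(2), of z] cT
      by (simp add: ac_simps)
  qed
  have "cyclic_permanent z (kronecker_product (a \<cdot>\<^sub>m 1\<^sub>m n + b \<cdot>\<^sub>m cyclic_perm_mat n) (all_ones_mat k))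
      = sum f (Pow ?S)"
    unfolding f_def by (rule cyclic_permanent_two_blocks[OF n k])
  \<comment> \<open>Only sets \<open>T\<close> with equally many indices in every block contribute;
    the common number is read off in block 0.\<close>
  also have "\<dots> = sum f (\<Union>s\<in>{0..k}. ?Q s)"
  proof (rule sum.mono_neutral_right)
    show "\<forall>T\<in>Pow ?S - (\<Union>s\<in>{0..k}. ?Q s). f T = 0"
    proof (rule ballI, rule ccontr)
      fix T assume T: "T \<in> Pow ?S - (\<Union>s\<in>{0..k}. ?Q s)" and "f T \<noteq> 0"
      then have "circuit_sum z ?S (\<lambda>x. x div k) (?h T) \<noteq> 0" by (auto simp: f_def)
      then have "card {x \<in> T. x div k = v} = card {x \<in> T. x div k = 0}" if "v < n" for v
        using circuit_sum_cycle_with_loops_eq_0[of ?S T "\<lambda>x. x div k" n z v] T lt that by blast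
      then have "T \<in> ?Q (card {x \<in> T. x div k = 0})" using T by blast
      moreover have "card {x \<in> T. x div k = 0} \<le> k" using card_le[of T 0] T n by simp
      ultimately show False using T by (meson DiffD2 UN_I atLeastAtMost_iff le0)
    qed
  qed auto
  also have "\<dots> = (\<Sum>s = 0..k. sum f (?Q s))"
  proof (rule sum.UNION_disjoint)
    show "\<forall>s\<in>{0..k}. finite (?Q s)" by (auto intro: finite_subset[of _ "Pow ?S"])
    \<comment> \<open>Since \<open>n \<ge> 1\<close>, there is a block whose count determines
      \<open>s\<close>.\<close>
    show "\<forall>s\<in>{0..k}. \<forall>t\<in>{0..k}. s \<noteq> t \<longrightarrow> ?Q s \<inter> ?Q t = {}"
      using n by fastforce
  qed simp
  also have "\<dots> = (\<Sum>s = 0..k. fact s ^ (n - 1) * pochhammer z s *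
      (of_nat (k choose s) * a ^ (k - s) * b ^ s * pochhammer (of_nat s + z) (k - s)) ^ n)"
  proof (intro sum.cong refl)
    fix s
    have "card (?Q s) = (\<Prod>v\<in>{..<n}. card {x \<in> ?S. x div k = v} choose s)"
      by (rule card_subsets_prescribed_fibers) (use lt in auto)
    also have "\<dots> = (k choose s) ^ n" using card_div_fiber[OF k] by simp
    finally have "card (?Q s) = (k choose s) ^ n" .
    then have "sum f (?Q s) = of_nat ((k choose s) ^ n) * (a ^ (n * (k - s)) * b ^ (n * s) *
      (fact s ^ (n - 1) * pochhammer z s * pochhammer (of_nat s + z) (k - s) ^ n))"
      using f_eq[of _ s] by simp
    then show "sum f (?Q s) = fact s ^ (n - 1) * pochhammer z s *
      (of_nat (k choose s) * a ^ (k - s) * b ^ s * pochhammer (of_nat s + z) (k - s)) ^ n"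
      by (simp add: power_mult_distrib ac_simps flip: power_mult)
  qed
  finally show ?thesis .
qed

section \<open>Passage to the polynomial ring\<close>

text \<open>The factorial taken in the polynomial ring is a constant polynomial, hence invertible
  through its coefficient.\<close>

lemma Const_inverse_fact:
  "Const (1 / fact s) * (fact s :: 'c::field_char_0 pol) = 1"
proof -
  have "(fact s :: 'c pol) = Poly_Mapping.single 0 (fact s)"
    by (metis of_nat_fact single_of_nat)
  then show ?thesis by (simp add: Const_def mult_single)
qed

theorem theorem7:
  fixes n k :: nat
  assumes "n \<ge> 1" and "k \<ge> 1"
  shows "cyclic_permanent (Var Z :: 'c::field_char_0 pol)
           (kronecker_product (Var A0 \<cdot>\<^sub>m 1\<^sub>m n + Var A1 \<cdot>\<^sub>m cyclic_perm_mat n) (all_ones_mat k))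
         = (\<Sum>s = 0..k. Const (1 / fact s) * pochhammer (Var Z) s *
              (of_nat (fact s * (k choose s)) * Var A0 ^ (k - s) * Var A1 ^ s
                 * pochhammer (of_nat s + Var Z) (k - s)) ^ n)"
  unfolding cyclic_permanent_two_blocks_closed[OF assms]
proof (intro sum.cong refl)
  fix s
  let ?r = "of_nat (k choose s) * Var A0 ^ (k - s) * Var A1 ^ s *
    pochhammer (of_nat s + Var Z) (k - s) :: 'c pol"
  obtain m where m: "n = Suc m" using assms(1) by (cases n) auto
  \<comment> \<open>As \<open>n\<close> is positive, one of the \<open>n\<close> factors cancels
    against the inverse.\<close>
  have "Const (1 / fact s) * (fact s :: 'c pol) ^ n = fact s ^ (n - 1)"
    using Const_inverse_fact[where 'c = 'c, of s] by (simp add: m flip: mult.assoc)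
  then have "fact s ^ (n - 1) * pochhammer (Var Z) s * ?r ^ n =
      Const (1 / fact s) * (fact s :: 'c pol) ^ n * pochhammer (Var Z) s * ?r ^ n"
    by (simp only:)
  also have "\<dots> = Const (1 / fact s) * pochhammer (Var Z) s * (fact s * ?r) ^ n"
    by (simp only: power_mult_distrib[of "fact s"] ac_simps)
  finally show "fact s ^ (n - 1) * pochhammer (Var Z) s * ?r ^ n =
      Const (1 / fact s) * pochhammer (Var Z) s *
        (of_nat (fact s * (k choose s)) * Var A0 ^ (k - s) * Var A1 ^ s
          * pochhammer (of_nat s + Var Z) (k - s)) ^ n"
    by (simp only: of_nat_mult of_nat_fact mult.assoc)
qed

end
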